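(* Let $\psi=\sigma_2^3\circ w_3$, $\phi=\sigma_2^4\circ w_0\circ w_2$ and $\varphi=\psi\circ\phi$ be the elements of the extended affine Weyl group $\widetilde W(E_3^{(1)})$, acting linearly on the rank $10$ lattice $\operatorname{Pic}(\mathcal X)$ as described in the context (they correspond to the discrete Painlevé equations $[000\overline11]$, $[01\overline100]$ and $[01\overline1\overline11]$, respectively). Then $\psi$, $\phi$ and $\varphi$ are pairwise non-conjugate. Indeed, writing $J(\lambda,m)$ for a Jordan block of size $m$ with eigenvalue $\lambda$, the Jordan forms of the induced linear maps on $\operatorname{Pic}(\mathcal X)\otimes\mathbb C$ are: - for $\psi$: $J(-1,1)^{\oplus3}\oplus J(1,1)^{\oplus4}\oplus J(1,3)$; - for $\phi$: $J(1,1)^{\oplus3}\oplus J(1,3)\oplus J(e^{2\pi i/3},1)^{\oplus2}\oplus J(e^{4\pi i/3},1)^{\oplus2}$; - for $\varphi$: $J(-1,1)\oplus J(1,1)^{\oplus2}\oplus J(1,3)\oplus J(e^{\pi i/3},1)\oplus J(e^{2\pi i/3},1)\oplus J(e^{4\pi i/3},1)\oplus J(e^{5\pi i/3},1)$.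
   Context: $\operatorname{Pic}(\mathcal X)$ is the free abelian group with basis $\mathcal H_f,\mathcal H_g,\mathcal E_1,\dots,\mathcal E_8$ and symmetric bilinear form $\bullet$ given by $\mathcal H_f\bullet\mathcal H_g=1$, $\mathcal E_i\bullet\mathcal E_i=-1$, all other products of basis elements being $0$. For $\alpha$ with $\alpha\bullet\alpha=-2$ the reflection is $w_\alpha(\mathcal C)=\mathcal C+(\mathcal C\bullet\alpha)\alpha$. Write $\mathcal E_{i\cdots j}=\mathcal E_i+\cdots+\mathcal E_j$. Put $\alpha_0=\mathcal H_f+\mathcal H_g-\mathcal E_{2367}$, $\alpha_1=\mathcal H_f-\mathcal E_{48}$, $\alpha_2=\mathcal H_g-\mathcal E_{15}$, $\alpha_3=\mathcal H_f+\mathcal H_g-\mathcal E_{2358}$, $\alpha_4=\mathcal H_f+\mathcal H_g-\mathcal E_{1467}$, and $w_i=w_{\alpha_i}$. Further put $$\sigma_0=w_{\mathcal E_5-\mathcal E_7}\circ w_{\mathcal E_4-\mathcal E_8}\circ w_{\mathcal E_1-\mathcal E_3}\circ w_{\mathcal E_2-\mathcal E_6}\circ w_{\mathcal H_f-\mathcal E_2-\mathcal E_6},\qquad \sigma_1=w_{\mathcal E_5-\mathcal E_8}\circ w_{\mathcal E_1-\mathcal E_4}\circ w_{\mathcal H_f-\mathcal H_g},\qquad \sigma_2=\sigma_1\circ\sigma_0 .$$ $\widetilde W(E_3^{(1)})$ is the group generated by $w_0,\dots,w_4,\sigma_0,\sigma_1$ acting on $\operatorname{Pic}(\mathcal X)$.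 Compositions are read from right to left. *)

theory Defs
  imports
    "HOL-Algebra.Free_Abelian_Groups"
    "HOL-Algebra.Bij"
    "HOL-Algebra.Generated_Groups"
    "Jordan_Normal_Form.Jordan_Normal_Form"
begin

section \<open>The Picard lattice\<close>

datatype pic_basis = bHf | bHg | bE1 | bE2 | bE3 | bE4 | bE5 | bE6 | bE7 | bE8

type_synonym pic = "pic_basis \<Rightarrow>\<^sub>0 int"

abbreviation Hf :: pic where "Hf \<equiv> frag_of bHf"
abbreviation Hg :: pic where "Hg \<equiv> frag_of bHg"
abbreviation E1 :: pic where "E1 \<equiv> frag_of bE1"
abbreviation E2 :: pic where "E2 \<equiv> frag_of bE2"
abbreviation E3 :: pic where "E3 \<equiv> frag_of bE3"
abbreviation E4 :: pic where "E4 \<equiv> frag_of bE4"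
abbreviation E5 :: pic where "E5 \<equiv> frag_of bE5"
abbreviation E6 :: pic where "E6 \<equiv> frag_of bE6"
abbreviation E7 :: pic where "E7 \<equiv> frag_of bE7"
abbreviation E8 :: pic where "E8 \<equiv> frag_of bE8"

definition pic_basis_list :: "pic_basis list" where
  "pic_basis_list = [bHf, bHg, bE1, bE2, bE3, bE4, bE5, bE6, bE7, bE8]"

lemma UNIV_pic_basis: "(UNIV :: pic_basis set) = {bHf, bHg, bE1, bE2, bE3, bE4, bE5, bE6, bE7, bE8}"
proof -
  have "x \<in> {bHf, bHg, bE1, bE2, bE3, bE4, bE5, bE6, bE7, bE8}" for x :: pic_basis
    by (cases x) simp_all
  then show ?thesis by blast
qed

instance pic_basis :: finite
  by standard (simp add: UNIV_pic_basis)

definition basis_form :: "pic_basis \<Rightarrow> pic_basis \<Rightarrow> int" where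
  "basis_form a b =
     (if {a, b} = {bHf, bHg} then 1
      else if a = b \<and> a \<notin> {bHf, bHg} then -1
      else 0)"

definition pic_form :: "pic \<Rightarrow> pic \<Rightarrow> int" where
  "pic_form C D =
     (\<Sum>a\<in>UNIV. \<Sum>b\<in>UNIV. Poly_Mapping.lookup C a * Poly_Mapping.lookup D b * basis_form a b)"

lemma pic_form_frag_of: "pic_form (frag_of a) (frag_of b) = basis_form a b"
proof -
  have "Poly_Mapping.lookup (frag_of a) x * Poly_Mapping.lookup (frag_of b) y * basis_form x y
        = (if x = a then if y = b then basis_form a b else 0 else 0)" for x y
    by (simp add: lookup_single)
  then show ?thesis
    by (simp add: pic_form_def sum.If_cases)
qed

text \<open>Only meant for \<open>\<alpha>\<close> with \<open>\<alpha> \<bullet> \<alpha> = -2\<close>.\<close>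

definition reflection :: "pic \<Rightarrow> pic \<Rightarrow> pic" where
  "reflection \<alpha> C = C + frag_cmul (pic_form C \<alpha>) \<alpha>"

section \<open>The extended affine Weyl group\<close>

definition simple_roots :: "pic list" where
  "simple_roots =
     [Hf + Hg - (E2 + E3 + E6 + E7),
      Hf - (E4 + E8),
      Hg - (E1 + E5),
      Hf + Hg - (E2 + E3 + E5 + E8),
      Hf + Hg - (E1 + E4 + E6 + E7)]"

definition alpha :: "nat \<Rightarrow> pic" where
  "alpha i = simple_roots ! i"

definition w :: "nat \<Rightarrow> pic \<Rightarrow> pic" where
  "w i = reflection (alpha i)"

definition sigma0 :: "pic \<Rightarrow> pic" where
  "sigma0 = reflection (E5 - E7) \<circ> reflection (E4 - E8) \<circ> reflection (E1 - E3)
            \<circ> reflection (E2 - E6) \<circ> reflection (Hf - E2 - E6)"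

definition sigma1 :: "pic \<Rightarrow> pic" where
  "sigma1 = reflection (E5 - E8) \<circ> reflection (E1 - E4) \<circ> reflection (Hf - Hg)"

definition sigma2 :: "pic \<Rightarrow> pic" where
  "sigma2 = sigma1 \<circ> sigma0"

text \<open>
  \<open>subgroup_generated\<close> discards generators outside the carrier of the ambient group; the lemma
  \<open>W_ext_generators\<close> below shows that nothing is discarded here.
\<close>

definition W_ext :: "(pic \<Rightarrow> pic) monoid" where
  "W_ext = subgroup_generated (AutoGroup (free_Abelian_group UNIV))
             {w 0, w 1, w 2, w 3, w 4, sigma0, sigma1}"

definition conjugate_in :: "('a, 'b) monoid_scheme \<Rightarrow> 'a \<Rightarrow> 'a \<Rightarrow> bool" where
  "conjugate_in G x y \<longleftrightarrow> (\<exists>g\<in>carrier G. y = g \<otimes>\<^bsub>G\<^esub> x \<otimes>\<^bsub>G\<^esub> inv\<^bsub>G\<^esub> g)"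

text \<open>The null root \<open>\<delta>\<close>, i.e. the anticanonical class.\<close>

definition delta :: pic where
  "delta = frag_cmul 2 Hf + frag_cmul 2 Hg - (E1 + E2 + E3 + E4 + E5 + E6 + E7 + E8)"

text \<open>
  The discrete equation labelled \<open>[c\<^sub>0 \<dots> c\<^sub>4]\<close> (an overline marking a negative entry)
  is the one whose element acts on the simple roots by \<open>\<alpha>\<^sub>i \<mapsto> \<alpha>\<^sub>i + c\<^sub>i \<delta>\<close>.
\<close>

definition translates_roots :: "(pic \<Rightarrow> pic) \<Rightarrow> int list \<Rightarrow> bool" where
  "translates_roots f c \<longleftrightarrow> (\<forall>i<5. f (alpha i) = alpha i + frag_cmul (c ! i) delta)"

definition psi :: "pic \<Rightarrow> pic" where
  "psi = sigma2 ^^ 3 \<circ> w 3"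

definition phi :: "pic \<Rightarrow> pic" where
  "phi = sigma2 ^^ 4 \<circ> w 0 \<circ> w 2"

definition varphi :: "pic \<Rightarrow> pic" where
  "varphi = psi \<circ> phi"

section \<open>Complexification\<close>

text \<open>
  For additive \<open>f\<close> this is the matrix of \<open>f \<otimes> id\<close> on \<open>Pic \<otimes> \<complex>\<close> in the basis
  \<open>b \<otimes> 1\<close>: column \<open>j\<close> holds the coordinates of the image of the \<open>j\<close>-th basis element.
\<close>

definition complexified_matrix :: "(pic \<Rightarrow> pic) \<Rightarrow> complex mat" where
  "complexified_matrix f = mat 10 10 (\<lambda>(i, j).
     complex_of_int (Poly_Mapping.lookup (f (frag_of (pic_basis_list ! j))) (pic_basis_list ! i)))"

section \<open>Sanity checks\<close>

lemma pic_form_add_left: "pic_form (C + D) A = pic_form C A + pic_form D A"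
  by (simp add: pic_form_def lookup_add distrib_right sum.distrib)

lemma pic_form_add_right: "pic_form A (C + D) = pic_form A C + pic_form A D"
  by (simp add: pic_form_def lookup_add distrib_left distrib_right sum.distrib)

lemma pic_form_diff_left: "pic_form (C - D) A = pic_form C A - pic_form D A"
  by (metis add_diff_cancel_right' diff_add_cancel pic_form_add_left)

lemma pic_form_diff_right: "pic_form A (C - D) = pic_form A C - pic_form A D"
  by (metis add_diff_cancel_right' diff_add_cancel pic_form_add_right)

lemma pic_form_cmul_left: "pic_form (frag_cmul k C) A = k * pic_form C A"
  by (simp add: pic_form_def sum_distrib_left mult.assoc)

lemmas pic_form_simps = pic_form_add_left pic_form_add_right pic_form_diff_left
  pic_form_diff_right pic_form_cmul_left pic_form_frag_of basis_form_def doubleton_eq_iff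

lemma reflection_add: "reflection \<alpha> (C + D) = reflection \<alpha> C + reflection \<alpha> D"
  by (simp add: reflection_def pic_form_add_left frag_cmul_distrib)

lemma reflection_involution:
  assumes "pic_form \<alpha> \<alpha> = -2"
  shows "reflection \<alpha> (reflection \<alpha> C) = C"
proof -
  have "pic_form (reflection \<alpha> C) \<alpha> = - pic_form C \<alpha>"
    by (simp add: reflection_def pic_form_add_left pic_form_cmul_left assms)
  then show ?thesis
    by (simp add: reflection_def [of \<alpha> "reflection \<alpha> C"]) (simp add: reflection_def flip: frag_cmul_distrib)
qed

lemma reflection_auto:
  assumes "pic_form \<alpha> \<alpha> = -2"
  shows "reflection \<alpha> \<in> auto (free_Abelian_group UNIV)"
  using involuntory_imp_bij [of "reflection \<alpha>"] reflection_involution [OF assms]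
  by (auto simp: auto_def hom_def Bij_def free_Abelian_group_def reflection_add)

lemma auto_comp:
  assumes "f \<in> auto (free_Abelian_group UNIV)" "g \<in> auto (free_Abelian_group UNIV)"
  shows "f \<circ> g \<in> auto (free_Abelian_group UNIV)"
  using assms
  by (auto simp: auto_def hom_def Bij_def free_Abelian_group_def intro: bij_comp)

lemma alpha_norm: "i < 5 \<Longrightarrow> pic_form (alpha i) (alpha i) = -2"
  by (auto simp: less_Suc_eq numeral_eq_Suc alpha_def simple_roots_def pic_form_simps)

lemma W_ext_generators:
  "{w 0, w 1, w 2, w 3, w 4, sigma0, sigma1} \<subseteq> carrier (AutoGroup (free_Abelian_group UNIV))"
proof -
  have "w i \<in> auto (free_Abelian_group UNIV)" if "i < 5" for i
    unfolding w_def using that by (intro reflection_auto alpha_norm)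
  moreover have "sigma0 \<in> auto (free_Abelian_group UNIV)"
    unfolding sigma0_def by (intro auto_comp reflection_auto; simp add: pic_form_simps)
  moreover have "sigma1 \<in> auto (free_Abelian_group UNIV)"
    unfolding sigma1_def by (intro auto_comp reflection_auto; simp add: pic_form_simps)
  ultimately show ?thesis
    by (simp add: AutoGroup_def)
qed

end

(*
  Conjugate elements of the extended affine Weyl group have similar complexified matrices, so
  non-conjugacy follows from the uniqueness of the Jordan normal form.  Each normal form is certified
  by an explicit Jordan basis together with vectors dual to it up to scaling; for phi and varphi these
  live over the Eisenstein integers, since all eigenvalues are sixth roots of unity.
*)
theory Submission
  imports Defs "Jordan_Normal_Form.Jordan_Normal_Form_Uniqueness"
begin

section \<open>Certifying Jordan normal forms\<close>

definition block_diagonal :: "(nat \<times> 'a) list \<Rightarrow> 'a list" where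
  "block_diagonal n_as = concat (map (\<lambda>(n, a). replicate n a) n_as)"

text \<open>The closing \<open>0\<close> of each block is the entry at the junction with the next
  block. For positive sizes it also makes positions agree with those in
  \<open>block_diagonal\<close>.\<close>

definition block_superdiagonal :: "(nat \<times> 'a) list \<Rightarrow> 'b :: zero_neq_one list" where
  "block_superdiagonal n_as = concat (map (\<lambda>(n, a). replicate (n - 1) 1 @ [0]) n_as)"

text \<open>Induction on the blocks, splitting off the first one as a diagonal summand. Sizes are
  positive because an empty block would still put a \<open>0\<close> into
  \<open>block_superdiagonal\<close> and shift all later entries.\<close>

lemma jordan_matrix_index:
  fixes n_as :: "(nat \<times> 'a :: zero_neq_one) list"
  assumes "0 \<notin> fst ` set n_as" "i < sum_list (map fst n_as)" "j < sum_list (map fst n_as)"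
  shows "jordan_matrix n_as $$ (i, j) =
    (if i = j then block_diagonal n_as ! i
     else if Suc i = j then block_superdiagonal n_as ! i else 0)"
  using assms
proof (induct n_as arbitrary: i j)
  case (Cons na n_as)
  obtain n a where na: "na = (n, a)" by force
  have n: "n > 0" using Cons.prems na by auto
  let ?m = "sum_list (map fst n_as)"
  have bd: "block_diagonal (na # n_as) = replicate n a @ block_diagonal n_as"
    and bs: "block_superdiagonal (na # n_as) = (replicate (n - 1) 1 @ [0]) @ (block_superdiagonal n_as :: 'a list)"
    by (simp_all add: block_diagonal_def block_superdiagonal_def na)
  have ij: "i < n + ?m" "j < n + ?m" using Cons.prems na by auto
  have idx: "jordan_matrix (na # n_as) $$ (i, j) =
    (if i < n then if j < n then jordan_block n a $$ (i, j) else 0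
     else if j < n then 0 else jordan_matrix n_as $$ (i - n, j - n))"
    unfolding na jordan_matrix_Cons using ij by (subst index_mat_four_block) auto
  have *: "jordan_matrix n_as $$ (i - n, j - n) =
    (if i - n = j - n then block_diagonal n_as ! (i - n)
     else if Suc (i - n) = j - n then block_superdiagonal n_as ! (i - n) else 0)"
    if "\<not> i < n" "\<not> j < n"
    using that ij Cons.prems by (intro Cons.hyps) auto
  \<comment> \<open>At the junction \<open>i = n - 1\<close>, \<open>j = n\<close> the entry lies in
    the zero corner of the block matrix; it matches the closing \<open>0\<close> of the first
    block.\<close>
  show ?case
    unfolding idx bd bs using * n
    by (auto simp: nth_append)
qed simp

text \<open>\<open>Q\<close> certifies that \<open>P\<close> is invertible: the triangular product
  \<open>Q * P\<close> has nonzero determinant, hence so has \<open>P\<close>. This avoids writing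
  down the inverse of \<open>P\<close> with its denominators.\<close>

lemma similar_mat_of_intertwiner:
  fixes A J P Q :: "'a :: field mat"
  assumes "A \<in> carrier_mat n n" "J \<in> carrier_mat n n" "P \<in> carrier_mat n n" "Q \<in> carrier_mat n n"
    and AP: "A * P = P * J"
    and QP: "upper_triangular (Q * P)" "0 \<notin> set (diag_mat (Q * P))"
  shows "similar_mat A J"
proof -
  have "det Q * det P = prod_list (diag_mat (Q * P))"
    using det_upper_triangular[OF QP(1), of n] assms(3,4) by (simp add: det_mult[of _ n])
  then have "det P \<noteq> 0" using QP(2) by (auto simp: prod_list_zero_iff)
  from det_non_zero_imp_unit[OF assms(3) this, of "()"]
  obtain R where R: "R \<in> carrier_mat n n" "R * P = 1\<^sub>m n" "P * R = 1\<^sub>m n"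
    unfolding Units_def ring_mat_def by auto
  have "P * J * R = A * (P * R)"
    using assms R by (simp add: assoc_mult_mat[of A n n P n R n] flip: AP)
  then have "A = P * J * R" using assms R by simp
  then show ?thesis using assms R by (intro similar_matI[of A J P R n]) auto
qed

definition dot_list :: "'a :: semiring_0 list \<Rightarrow> 'a list \<Rightarrow> 'a" where
  "dot_list xs ys = sum_list (map2 (*) xs ys)"

lemma dot_list_eq_sum:
  assumes "length xs = n" "length ys = n"
  shows "dot_list xs ys = (\<Sum>i = 0..<n. xs ! i * ys ! i)"
  using assms by (simp add: dot_list_def sum_list_sum_nth)

text \<open>
  \<open>B\<close> and \<open>C\<close> list the basis vectors and the dual vectors. For \<open>j = 0\<close> the vector \<open>B ! (j - 1)\<close> is
  \<open>B ! 0\<close> by truncation; its coefficient is the prepended \<open>0\<close>.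
\<close>

lemma jordan_nf_of_jordan_basis:
  fixes A B C :: "'a :: field list list"
  assumes n: "n = sum_list (map fst n_as)" "0 \<notin> fst ` set n_as"
    and len: "length A = n" "length B = n" "length C = n"
      "\<And>r. r \<in> set A \<union> set B \<union> set C \<Longrightarrow> length r = n"
    and chain: "\<forall>j<n. map (\<lambda>r. dot_list r (B ! j)) A =
       map2 (\<lambda>x y. block_diagonal n_as ! j * x + (0 # block_superdiagonal n_as) ! j * y)
         (B ! j) (B ! (j - 1))"
    and dual: "\<forall>i<n. \<forall>j<n. dot_list (C ! i) (B ! j) = 0 \<longleftrightarrow> i \<noteq> j"
  shows "jordan_nf (mat_of_rows_list n A) n_as"
proof -
  let ?A = "mat_of_rows_list n A" and ?J = "jordan_matrix n_as"
  \<comment> \<open>The basis vectors are the columns of \<open>P\<close> and the dual vectors the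
    rows of \<open>Q\<close>, so the entries of \<open>Q * P\<close> are the pairings in
    \<open>dual\<close>.\<close>
  let ?P = "mat n n (\<lambda>(i, j). B ! j ! i)" and ?Q = "mat n n (\<lambda>(i, j). C ! i ! j)"
  have lenA: "length (A ! i) = n" and lenB: "length (B ! i) = n" and lenC: "length (C ! i) = n"
    if "i < n" for i
    using that len(1-3) len(4) by (metis UnI1 UnI2 nth_mem)+
  have car: "?A \<in> carrier_mat n n" "?J \<in> carrier_mat n n"
    unfolding mat_of_rows_list_def len(1) by (rule mat_carrier) (unfold n(1), rule jordan_matrix_carrier)
  have QP: "(?Q * ?P) $$ (i, j) = dot_list (C ! i) (B ! j)" if "i < n" "j < n" for i j
    using that lenB lenC by (simp add: scalar_prod_def dot_list_eq_sum[of _ n])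
  have "?A * ?P = ?P * ?J"
  proof (rule eq_matI)
    fix i j assume "i < dim_row (?P * ?J)" "j < dim_col (?P * ?J)"
    then have i: "i < n" and j: "j < n" by (simp_all add: n(1))
    have "(?A * ?P) $$ (i, j) = dot_list (A ! i) (B ! j)"
      using i j len(1) lenA lenB
      by (simp add: mat_of_rows_list_def scalar_prod_def dot_list_eq_sum[of _ n])
    also have "\<dots> = map (\<lambda>r. dot_list r (B ! j)) A ! i" using i len(1) by simp
    also have "\<dots> = block_diagonal n_as ! j * B ! j ! i + (0 # block_superdiagonal n_as) ! j * B ! (j - 1) ! i"
      using i j lenB by (simp add: chain)
    \<comment> \<open>Column \<open>j\<close> of a Jordan matrix is supported in rows
      \<open>j\<close> and \<open>j - 1\<close>; these are the two terms that remain of the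
      sum.\<close>
    also have "\<dots> = (\<Sum>k = 0..<n. B ! k ! i * (if k = j then block_diagonal n_as ! k
          else if Suc k = j then block_superdiagonal n_as ! k else 0))"
    proof (cases j)
      case 0
      then show ?thesis using j
        by (subst sum.remove[of _ 0]) (auto intro!: sum.neutral)
    next
      case (Suc k)
      then show ?thesis using j
        by (subst sum.remove[of _ j], simp, simp, subst sum.remove[of _ k])
           (auto intro!: sum.neutral)
    qed
    also have "\<dots> = (?P * ?J) $$ (i, j)"
      using i j n(2) by (simp add: scalar_prod_def jordan_matrix_index n(1)[symmetric])
    finally show "(?A * ?P) $$ (i, j) = (?P * ?J) $$ (i, j)" .
  qed (use car in auto)
  \<comment> \<open>One direction of \<open>dual\<close> makes \<open>Q * P\<close> even diagonal;
    the other makes the diagonal entries nonzero.\<close>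
  moreover have "upper_triangular (?Q * ?P)"
    by (rule upper_triangularI) (simp add: QP dual del: index_mult_mat(1))
  moreover have "0 \<notin> set (diag_mat (?Q * ?P))"
    by (auto simp add: diag_mat_def QP dual simp del: index_mult_mat(1))
  ultimately have "similar_mat ?A ?J"
    by (intro similar_mat_of_intertwiner[OF car, of ?P ?Q]) auto
  then show ?thesis using n(2) by (simp add: jordan_nf_def)
qed

section \<open>Coordinates on the Picard lattice\<close>

text \<open>Explicit coordinate lists turn computations in \<open>pic\<close> into integer
  arithmetic on ten entries, which the simplifier can carry out.\<close>

definition pic_vec :: "int list \<Rightarrow> pic" where
  "pic_vec xs = (\<Sum>i<10. frag_cmul (xs ! i) (frag_of (pic_basis_list ! i)))"

lemma lookup_pic_vec:
  "Poly_Mapping.lookup (pic_vec [a0, a1, a2, a3, a4, a5, a6, a7, a8, a9]) b =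
     (case b of bHf \<Rightarrow> a0 | bHg \<Rightarrow> a1 | bE1 \<Rightarrow> a2 | bE2 \<Rightarrow> a3 | bE3 \<Rightarrow> a4
        | bE4 \<Rightarrow> a5 | bE5 \<Rightarrow> a6 | bE6 \<Rightarrow> a7 | bE7 \<Rightarrow> a8 | bE8 \<Rightarrow> a9)"
  by (cases b) (simp_all add: pic_vec_def pic_basis_list_def numeral_eq_Suc lookup_add)

lemma frag_of_eq_pic_vec:
  "Hf = pic_vec [1, 0, 0, 0, 0, 0, 0, 0, 0, 0]"
  "Hg = pic_vec [0, 1, 0, 0, 0, 0, 0, 0, 0, 0]"
  "E1 = pic_vec [0, 0, 1, 0, 0, 0, 0, 0, 0, 0]"
  "E2 = pic_vec [0, 0, 0, 1, 0, 0, 0, 0, 0, 0]"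
  "E3 = pic_vec [0, 0, 0, 0, 1, 0, 0, 0, 0, 0]"
  "E4 = pic_vec [0, 0, 0, 0, 0, 1, 0, 0, 0, 0]"
  "E5 = pic_vec [0, 0, 0, 0, 0, 0, 1, 0, 0, 0]"
  "E6 = pic_vec [0, 0, 0, 0, 0, 0, 0, 1, 0, 0]"
  "E7 = pic_vec [0, 0, 0, 0, 0, 0, 0, 0, 1, 0]"
  "E8 = pic_vec [0, 0, 0, 0, 0, 0, 0, 0, 0, 1]"
  by (simp_all add: pic_vec_def pic_basis_list_def numeral_eq_Suc)

lemma pic_vec_add:
  "pic_vec [a0, a1, a2, a3, a4, a5, a6, a7, a8, a9] + pic_vec [b0, b1, b2, b3, b4, b5, b6, b7, b8, b9] =
   pic_vec [a0+b0, a1+b1, a2+b2, a3+b3, a4+b4, a5+b5, a6+b6, a7+b7, a8+b8, a9+b9]"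
  by (rule poly_mapping_eqI) (simp add: lookup_add lookup_pic_vec split: pic_basis.split)

lemma pic_vec_diff:
  "pic_vec [a0, a1, a2, a3, a4, a5, a6, a7, a8, a9] - pic_vec [b0, b1, b2, b3, b4, b5, b6, b7, b8, b9] =
   pic_vec [a0-b0, a1-b1, a2-b2, a3-b3, a4-b4, a5-b5, a6-b6, a7-b7, a8-b8, a9-b9]"
  by (rule poly_mapping_eqI) (simp add: lookup_minus lookup_pic_vec split: pic_basis.split)

lemma pic_vec_cmul:
  "frag_cmul k (pic_vec [a0, a1, a2, a3, a4, a5, a6, a7, a8, a9]) =
   pic_vec [k*a0, k*a1, k*a2, k*a3, k*a4, k*a5, k*a6, k*a7, k*a8, k*a9]"
  by (rule poly_mapping_eqI) (simp add: lookup_pic_vec split: pic_basis.split)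

lemma pic_form_pic_vec:
  "pic_form (pic_vec [a0, a1, a2, a3, a4, a5, a6, a7, a8, a9])
            (pic_vec [b0, b1, b2, b3, b4, b5, b6, b7, b8, b9]) =
   a0 * b1 + a1 * b0 - a2 * b2 - a3 * b3 - a4 * b4 - a5 * b5 - a6 * b6 - a7 * b7 - a8 * b8 - a9 * b9"
  by (simp add: pic_form_def UNIV_pic_basis lookup_pic_vec basis_form_def doubleton_eq_iff)

lemmas pic_vec_simps = frag_of_eq_pic_vec pic_vec_add pic_vec_diff pic_vec_cmul pic_form_pic_vec

text \<open>The second equation is stated for \<open>Suc 0\<close>, the simp normal form of the
  index 1.\<close>

lemma alpha_vec:
  "alpha 0 = pic_vec [1, 1, 0, -1, -1, 0, 0, -1, -1, 0]"
  "alpha (Suc 0) = pic_vec [1, 0, 0, 0, 0, -1, 0, 0, 0, -1]"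
  "alpha 2 = pic_vec [0, 1, -1, 0, 0, 0, -1, 0, 0, 0]"
  "alpha 3 = pic_vec [1, 1, 0, -1, -1, 0, -1, 0, 0, -1]"
  "alpha 4 = pic_vec [1, 1, -1, 0, 0, -1, 0, -1, -1, 0]"
  by (simp_all add: alpha_def simple_roots_def pic_vec_simps)

lemma delta_vec: "delta = pic_vec [2, 2, -1, -1, -1, -1, -1, -1, -1, -1]"
  by (simp add: delta_def pic_vec_simps)

lemma sigma0_pic_vec:
  "sigma0 (pic_vec [a0, a1, a2, a3, a4, a5, a6, a7, a8, a9]) =
   pic_vec [a0 + a1 + a3 + a7, a1, a4, - a1 - a3, a2, a9, a8, - a1 - a7, a6, a5]"
  by (simp add: sigma0_def reflection_def pic_vec_simps algebra_simps)

lemma sigma1_pic_vec: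
  "sigma1 (pic_vec [a0, a1, a2, a3, a4, a5, a6, a7, a8, a9]) =
   pic_vec [a1, a0, a5, a3, a4, a2, a9, a7, a8, a6]"
  by (simp add: sigma1_def reflection_def pic_vec_simps algebra_simps)

text \<open>Since \<open>psi\<close> and \<open>phi\<close> iterate \<open>sigma2\<close>, one
  closed formula replaces eight reflections per iteration.\<close>

lemma sigma2_pic_vec:
  "sigma2 (pic_vec [a0, a1, a2, a3, a4, a5, a6, a7, a8, a9]) =
   pic_vec [a1, a0 + a1 + a3 + a7, a9, - a1 - a3, a2, a4, a5, - a1 - a7, a6, a8]"
  by (simp add: sigma2_def sigma0_pic_vec sigma1_pic_vec algebra_simps)

section \<open>The three elements in coordinates and their bracket labels\<close>

lemma psi_eq: "psi C = sigma2 (sigma2 (sigma2 (reflection (alpha 3) C)))"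
  by (simp add: psi_def w_def eval_nat_numeral)

lemma phi_eq: "phi C = sigma2 (sigma2 (sigma2 (sigma2 (reflection (alpha 0) (reflection (alpha 2) C)))))"
  by (simp add: phi_def w_def eval_nat_numeral)

lemmas element_simps = psi_eq phi_eq varphi_def alpha_vec sigma2_pic_vec reflection_def pic_vec_simps

text \<open>An explicit index set leaves five coordinate identities, which confirm the label of each
  equation.\<close>

lemma translates_roots_iff:
  "translates_roots f c \<longleftrightarrow> (\<forall>i\<in>{0, 1, 2, 3, 4}. f (alpha i) = alpha i + frag_cmul (c ! i) delta)"
proof -
  have "{0, 1, 2, 3, 4} = {..<5::nat}" by auto
  then show ?thesis by (simp only: translates_roots_def Ball_def lessThan_iff)
qed

lemma translates_roots_psi: "translates_roots psi [0, 0, 0, -1, 1]"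
  by (simp add: translates_roots_iff element_simps delta_vec)

lemma translates_roots_phi: "translates_roots phi [0, 1, -1, 0, 0]"
  by (simp add: translates_roots_iff element_simps delta_vec)

lemma translates_roots_varphi: "translates_roots varphi [0, 1, -1, -1, 1]"
  by (simp add: translates_roots_iff element_simps delta_vec)

section \<open>Complexified matrices\<close>

definition psi_rows :: "int list list" where
  "psi_rows =
     [[2, 1, 0, 1, 1, 0, 1, 0, 0, 1],
      [1, 2, 0, 1, 1, 0, 1, 0, 0, 1],
      [-1, -1, 0, -1, -1, 0, 0, 0, 0, -1],
      [0, 0, 0, 0, 0, 0, 0, 1, 0, 0],
      [0, 0, 0, 0, 0, 0, 0, 0, 1, 0],
      [-1, -1, 0, -1, -1, 0, -1, 0, 0, 0],
      [0, 0, 1, 0, 0, 0, 0, 0, 0, 0],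
      [-1, -1, 0, 0, -1, 0, -1, 0, 0, -1],
      [-1, -1, 0, -1, 0, 0, -1, 0, 0, -1],
      [0, 0, 0, 0, 0, 1, 0, 0, 0, 0]]"

definition phi_rows :: "int list list" where
  "phi_rows =
     [[3, 2, 2, 1, 1, 0, 2, 1, 1, 0],
      [2, 1, 1, 1, 0, 0, 1, 1, 0, 0],
      [0, 0, 0, 0, 0, 1, 0, 0, 0, 0],
      [-1, -1, -1, 0, 0, 0, -1, -1, 0, 0],
      [-1, 0, -1, 0, 0, 0, 0, 0, 0, 0],
      [-2, -1, -1, -1, -1, 0, -1, -1, 0, 0],
      [0, 0, 0, 0, 0, 0, 0, 0, 0, 1],
      [-1, -1, -1, -1, 0, 0, -1, 0, 0, 0],
      [-1, 0, 0, 0, 0, 0, -1, 0, 0, 0],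
      [-2, -1, -1, -1, 0, 0, -1, -1, -1, 0]]"

definition varphi_rows :: "int list list" where
  "varphi_rows =
     [[4, 3, 2, 2, 2, 0, 3, 1, 1, 1],
      [3, 2, 1, 2, 1, 0, 2, 1, 0, 1],
      [-1, -1, 0, -1, -1, 0, -1, 0, 0, 0],
      [-1, -1, -1, -1, 0, 0, -1, 0, 0, 0],
      [-1, 0, 0, 0, 0, 0, -1, 0, 0, 0],
      [-3, -2, -1, -2, -1, 0, -2, -1, -1, -1],
      [0, 0, 0, 0, 0, 1, 0, 0, 0, 0],
      [-2, -2, -1, -1, -1, 0, -2, -1, 0, -1],
      [-2, -1, -1, -1, -1, 0, -1, 0, 0, -1],
      [-2, -1, -1, -1, -1, 0, -1, -1, 0, 0]]"

text \<open>Images of basis elements are columns of the matrix, so each stored row is read at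
  position \<open>j\<close>.\<close>

lemma psi_basis:
  "map (psi \<circ> frag_of) pic_basis_list = map (\<lambda>j. pic_vec (map (\<lambda>r. r ! j) psi_rows)) [0..<10]"
  by (simp add: pic_basis_list_def psi_rows_def upt_rec element_simps)

lemma phi_basis:
  "map (phi \<circ> frag_of) pic_basis_list = map (\<lambda>j. pic_vec (map (\<lambda>r. r ! j) phi_rows)) [0..<10]"
  by (simp add: pic_basis_list_def phi_rows_def upt_rec element_simps)

lemma varphi_basis:
  "map (varphi \<circ> frag_of) pic_basis_list = map (\<lambda>j. pic_vec (map (\<lambda>r. r ! j) varphi_rows)) [0..<10]"
  by (simp add: pic_basis_list_def varphi_rows_def upt_rec element_simps)

lemma pic_basis_list_nth_eq_iff:
  "i < 10 \<Longrightarrow> j < 10 \<Longrightarrow> pic_basis_list ! i = pic_basis_list ! j \<longleftrightarrow> i = j"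
  by (intro nth_eq_iff_index_eq) (simp_all add: pic_basis_list_def)

lemma length_pic_basis_list: "length pic_basis_list = 10"
  by (simp add: pic_basis_list_def)

lemma complexified_matrix_eq:
  assumes "length R = 10"
    and "map (f \<circ> frag_of) pic_basis_list = map (\<lambda>j. pic_vec (map (\<lambda>r. r ! j) R)) [0..<10]"
    and "\<And>r. r \<in> set R \<Longrightarrow> length r = 10"
  shows "complexified_matrix f = mat_of_rows_list 10 (map (map complex_of_int) R)"
proof (rule eq_matI)
  fix i j
  assume "i < dim_row (mat_of_rows_list 10 (map (map complex_of_int) R))"
    "j < dim_col (mat_of_rows_list 10 (map (map complex_of_int) R))"
  then have i: "i < 10" and j: "j < 10" using assms(1) by (simp_all add: mat_of_rows_list_def)
  have "f (frag_of (pic_basis_list ! j)) = map (f \<circ> frag_of) pic_basis_list ! j"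
    using j by (simp add: length_pic_basis_list)
  also have "\<dots> = pic_vec (map (\<lambda>r. r ! j) R)" using j by (simp add: assms(2) del: upt_rec_numeral)
  finally have *: "f (frag_of (pic_basis_list ! j)) = pic_vec (map (\<lambda>r. r ! j) R)" .
  \<comment> \<open>The list is not explicit here, so \<open>lookup_pic_vec\<close> does not apply;
    the coordinate is read off the defining sum, using that the basis elements are distinct.\<close>
  have "Poly_Mapping.lookup (pic_vec xs) (pic_basis_list ! i) = xs ! i" for xs
  proof -
    have "Poly_Mapping.lookup (pic_vec xs) (pic_basis_list ! i) = (\<Sum>k<10. if i = k then xs ! k else 0)"
      unfolding pic_vec_def lookup_sum using i
      by (intro sum.cong) (auto simp: lookup_single pic_basis_list_nth_eq_iff)
    then show ?thesis using i by simp
  qed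
  then show "complexified_matrix f $$ (i, j) = mat_of_rows_list 10 (map (map complex_of_int) R) $$ (i, j)"
    using i j assms by (simp add: complexified_matrix_def mat_of_rows_list_def *)
qed (simp_all add: complexified_matrix_def mat_of_rows_list_def assms)

lemma complexified_matrix_psi:
  "complexified_matrix psi = mat_of_rows_list 10 (map (map complex_of_int) psi_rows)"
  by (rule complexified_matrix_eq[OF _ psi_basis]) (auto simp: psi_rows_def)

lemma complexified_matrix_phi:
  "complexified_matrix phi = mat_of_rows_list 10 (map (map complex_of_int) phi_rows)"
  by (rule complexified_matrix_eq[OF _ phi_basis]) (auto simp: phi_rows_def)

lemma complexified_matrix_varphi:
  "complexified_matrix varphi = mat_of_rows_list 10 (map (map complex_of_int) varphi_rows)"
  by (rule complexified_matrix_eq[OF _ varphi_basis]) (auto simp: varphi_rows_def)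

section \<open>Explicit Jordan bases of the three matrices\<close>

lemma jordan_nf_psi_rows:
  "jordan_nf (mat_of_rows_list 10 (map (map complex_of_int) psi_rows))
    (replicate 3 (1, -1) @ replicate 4 (1, 1) @ [(3, 1)])"
\<comment> \<open>The last three vectors are \<open>delta\<close>, \<open>alpha 4\<close> and
  \<open>Hf\<close>: \<open>psi - id\<close> maps \<open>Hf\<close> to \<open>alpha 4\<close> and
  \<open>alpha 4\<close> to \<open>delta\<close>. The last dual vector is the pairing with
  \<open>delta\<close> under \<bullet>, which vanishes on all the other basis vectors.\<close>
proof (rule jordan_nf_of_jordan_basis[where
      B = "[[0, 0, - 1, - 1, 0, 0, 1, 1, 0, 0],
       [0, 0, - 1, 0, - 1, 0, 1, 0, 1, 0],
       [0, 0, 1, 0, 0, - 1, - 1, 0, 0, 1],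
       [- 1, 1, 0, 0, 0, 0, 0, 0, 0, 0],
       [- 1, 0, 1, 0, 0, 0, 1, 0, 0, 0],
       [- 1, 0, 0, 1, 0, 0, 0, 1, 0, 0],
       [- 1, 0, 0, 0, 1, 0, 0, 0, 1, 0],
       [2, 2, - 1, - 1, - 1, - 1, - 1, - 1, - 1, - 1],
       [1, 1, - 1, 0, 0, - 1, 0, - 1, - 1, 0],
       [1, 0, 0, 0, 0, 0, 0, 0, 0, 0]]"
      and C = "[[0, 0, - 1, - 3, 1, - 1, 1, 3, - 1, 1],
       [0, 0, - 1, 1, - 3, - 1, 1, - 1, 3, 1],
       [0, 0, 1, - 1, - 1, - 3, - 1, 1, 1, 3],
       [0, 1, 0, 0, 0, 1, 0, 0, 0, 1],
       [0, 0, 1, 0, 0, - 1, 1, 0, 0, - 1],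
       [0, 0, 0, 1, 0, - 1, 0, 1, 0, - 1],
       [0, 0, 0, 0, 1, - 1, 0, 0, 1, - 1],
       [0, 0, 1, - 1, - 1, - 3, - 1, 1, 1, - 5],
       [0, 0, - 1, 1, 1, - 1, 1, - 1, - 1, 1],
       [2, 2, 1, 1, 1, 1, 1, 1, 1, 1]]"], goal_cases dim blocks A B C rows chain dual)
  case chain
  show ?case
    by (simp add: psi_rows_def dot_list_def block_diagonal_def block_superdiagonal_def All_less_Suc
        numeral_eq_Suc algebra_simps)
next
  case dual
  show ?case
    by (simp add: dot_list_def All_less_Suc numeral_eq_Suc algebra_simps)
qed (auto simp: psi_rows_def sum_list_replicate)

text \<open>Keeping \<omega> symbolic with its quadratic relation confines the arithmetic to
  \<open>a + b * \<omega>\<close> with integers \<open>a\<close>, \<open>b\<close>. The other root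
  of the relation is \<open>- 1 - \<omega>\<close>.\<close>

lemma jordan_nf_phi_rows:
  assumes w: "\<omega> * \<omega> = - 1 - \<omega>"
  shows "jordan_nf (mat_of_rows_list 10 (map (map complex_of_int) phi_rows))
    (replicate 3 (1, 1) @ [(3, 1)] @ replicate 2 (1, \<omega>) @ replicate 2 (1, - 1 - \<omega>))"
proof -
  \<comment> \<open>Right-nested products produced by \<open>algebra_simps\<close> hide the factor
    \<open>\<omega> * \<omega>\<close> from \<open>w\<close>; this variant reduces them too.\<close>
  have w': "\<omega> * (\<omega> * x) = - x - \<omega> * x" for x
    by (simp add: w algebra_simps flip: mult.assoc)
  show ?thesis
  \<comment> \<open>The chain ends in \<open>alpha 1 - alpha 2\<close>, which
    \<open>phi - id\<close> maps to twice \<open>delta\<close>, and is topped by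
    \<open>Hg - E1 + E3 + E8\<close>. The last two vectors of \<open>B\<close> and of
    \<open>C\<close> come from the preceding two by exchanging \<omega> and
    \<open>- 1 - \<omega>\<close>.\<close>
  proof (rule jordan_nf_of_jordan_basis[where
        B = "[[0, 0, 1, - 1, - 1, 1, 0, 0, 0, 0],
         [0, 0, 0, - 1, 0, 0, 0, 1, 0, 0],
         [- 1, - 1, 0, 2, 1, 0, 0, 0, 1, 0],
         [4, 4, - 2, - 2, - 2, - 2, - 2, - 2, - 2, - 2],
         [1, - 1, 1, 0, 0, - 1, 1, 0, 0, - 1],
         [0, 1, - 1, 0, 1, 0, 0, 0, 0, 1],
         [- \<omega>, 1 + \<omega>, \<omega>, - 1, 0, - 1 - \<omega>, 0, - 1, 1, 0],
         [1 + \<omega>, - 1, 0, - \<omega>, \<omega>, 0, - 1 - \<omega>, - \<omega>, 0, 1],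
         [1 + \<omega>, - \<omega>, - 1 - \<omega>, - 1, 0, \<omega>, 0, - 1, 1, 0],
         [- \<omega>, - 1, 0, 1 + \<omega>, - 1 - \<omega>, 0, \<omega>, 1 + \<omega>, 0, 1]]"
        and C = "[[2, 2, 2, 1, 0, 2, 0, 1, 2, 0],
         [1, 1, 0, - 1, 1, 0, - 2, 5, 3, - 2],
         [3, 3, 2, 3, 1, 2, - 2, 3, 5, - 2],
         [7, 7, 2, 5, - 1, 2, - 4, 5, 5, - 4],
         [3, 1, 2, 1, 1, 0, 2, 1, 1, 0],
         [2, 2, 1, 1, 1, 1, 1, 1, 1, 1],
         [\<omega>, - 1 - \<omega>, - 2 - 2 * \<omega>, - 1, - 1, 2 * \<omega>, 1 + \<omega>, - 1, 2, - \<omega>],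
         [1, \<omega>, - \<omega>, 1 + \<omega>, - 2 - 2 * \<omega>, - 1, 2 * \<omega>, 1 + \<omega>, 1 + \<omega>, 2],
         [- 1 - \<omega>, \<omega>, 2 * \<omega>, - 1, - 1, - 2 - 2 * \<omega>, - \<omega>, - 1, 2, 1 + \<omega>],
         [1, - 1 - \<omega>, 1 + \<omega>, - \<omega>, 2 * \<omega>, - 1, - 2 - 2 * \<omega>, - \<omega>, - \<omega>, 2]]"], goal_cases dim blocks A B C rows chain dual)
    case chain
    show ?case
      by (simp add: phi_rows_def dot_list_def block_diagonal_def block_superdiagonal_def All_less_Suc
          numeral_eq_Suc algebra_simps w w')
  next
    case dual
    show ?case
      by (simp add: dot_list_def All_less_Suc numeral_eq_Suc algebra_simps w w')
  qed (auto simp: phi_rows_def sum_list_replicate)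
qed

text \<open>Here \<open>1 + \<omega>\<close> and \<open>- \<omega>\<close> are the two primitive
  sixth roots of unity, so the same ring suffices.\<close>

lemma jordan_nf_varphi_rows:
  assumes w: "\<omega> * \<omega> = - 1 - \<omega>"
  shows "jordan_nf (mat_of_rows_list 10 (map (map complex_of_int) varphi_rows))
    ([(1, -1)] @ replicate 2 (1, 1) @ [(3, 1)] @ [(1, 1 + \<omega>), (1, \<omega>), (1, - 1 - \<omega>), (1, - \<omega>)])"
proof -
  have w': "\<omega> * (\<omega> * x) = - x - \<omega> * x" for x
    by (simp add: w algebra_simps flip: mult.assoc)
  show ?thesis
  \<comment> \<open>The chain arises by applying \<open>varphi - id\<close> twice to
    \<open>Hf + Hg + E3 + E7\<close>, which gives 7 times \<open>delta\<close>. As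
    \<open>varphi\<close> preserves \<bullet>, the last four dual vectors are, up to sign, the
    pairings with the eigenvectors for the inverse eigenvalues.\<close>
  proof (rule jordan_nf_of_jordan_basis[where
        B = "[[0, 0, - 1, - 3, 1, - 1, 1, 3, - 1, 1],
         [0, - 1, 2, - 1, - 1, 1, 1, 0, 0, 0],
         [- 1, - 1, 0, 1, 1, 0, 0, 1, 1, 0],
         [14, 14, - 7, - 7, - 7, - 7, - 7, - 7, - 7, - 7],
         [9, 5, - 3, - 2, - 2, - 7, 0, - 5, - 5, - 4],
         [1, 1, 0, 0, 1, 0, 0, 0, 1, 0],
         [0, 0, - \<omega>, 0, - 1 - \<omega>, - 1, \<omega>, 0, 1 + \<omega>, 1],
         [2 + 2 * \<omega>, - 2, - 1 - \<omega>, - 2 * \<omega>, \<omega>, 1, - 1 - \<omega>, - 2 * \<omega>, \<omega>, 1],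
         [- 2 * \<omega>, - 2, \<omega>, 2 + 2 * \<omega>, - 1 - \<omega>, 1, \<omega>, 2 + 2 * \<omega>, - 1 - \<omega>, 1],
         [0, 0, 1 + \<omega>, 0, \<omega>, - 1, - 1 - \<omega>, 0, - \<omega>, 1]]"
        and C = "[[0, 0, - 1, - 3, 1, - 1, 1, 3, - 1, 1],
         [1, - 1, 2, - 1, - 1, 0, 0, 1, 1, - 2],
         [1, - 8, 2, - 1, - 1, - 7, - 7, 8, 8, - 16],
         [16, 40, 11, - 79, - 163, 35, - 259, 191, 107, - 235],
         [4, - 4, 1, 3, 3, - 7, 7, - 3, - 3, - 1],
         [2, 2, 1, 1, 1, 1, 1, 1, 1, 1],
         [0, 0, 1 + \<omega>, 0, \<omega>, - 1, - 1 - \<omega>, 0, - \<omega>, 1],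
         [2, 2 * \<omega>, \<omega>, 2 + 2 * \<omega>, - 1 - \<omega>, 1, \<omega>, 2 + 2 * \<omega>, - 1 - \<omega>, 1],
         [2, - 2 - 2 * \<omega>, - 1 - \<omega>, - 2 * \<omega>, \<omega>, 1, - 1 - \<omega>, - 2 * \<omega>, \<omega>, 1],
         [0, 0, - \<omega>, 0, - 1 - \<omega>, - 1, \<omega>, 0, 1 + \<omega>, 1]]"], goal_cases dim blocks A B C rows chain dual)
    case chain
    show ?case
      by (simp add: varphi_rows_def dot_list_def block_diagonal_def block_superdiagonal_def All_less_Suc
          numeral_eq_Suc algebra_simps w w')
  next
    case dual
    show ?case
      by (simp add: dot_list_def All_less_Suc numeral_eq_Suc algebra_simps w w')
  qed (auto simp: varphi_rows_def sum_list_replicate)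
qed

section \<open>Conjugacy in the extended affine Weyl group\<close>

lemma group_AutoGroup_pic: "group (AutoGroup (free_Abelian_group (UNIV :: pic_basis set)))"
  by (simp add: group.AutoGroup)

lemma W_ext_subset_auto: "carrier W_ext \<subseteq> auto (free_Abelian_group UNIV)"
  using group.carrier_subgroup_generated_subset[OF group_AutoGroup_pic]
  by (simp add: W_ext_def AutoGroup_def)

lemma auto_pic_iff: "f \<in> auto (free_Abelian_group (UNIV :: pic_basis set)) \<longleftrightarrow> bij f \<and> (\<forall>C D. f (C + D) = f C + f D)"
  by (auto simp: auto_def Bij_def hom_def free_Abelian_group_def)

text \<open>The product of \<open>AutoGroup\<close> is composition restricted to the carrier of the
  lattice, and that carrier is the whole type.\<close>

lemma W_ext_mult:
  assumes "f \<in> carrier W_ext" "g \<in> carrier W_ext"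
  shows "f \<otimes>\<^bsub>W_ext\<^esub> g = f \<circ> g"
  using subsetD[OF W_ext_subset_auto, OF assms(1)] subsetD[OF W_ext_subset_auto, OF assms(2)]
  by (simp add: W_ext_def AutoGroup_def BijGroup_def auto_def compose_def free_Abelian_group_def fun_eq_iff)

lemma W_ext_one: "\<one>\<^bsub>W_ext\<^esub> = id"
  by (auto simp: W_ext_def AutoGroup_def BijGroup_def free_Abelian_group_def)

lemma group_W_ext: "group W_ext"
  unfolding W_ext_def by (rule group.group_subgroup_generated[OF group_AutoGroup_pic])

lemma W_ext_comp_closed:
  "f \<in> carrier W_ext \<Longrightarrow> g \<in> carrier W_ext \<Longrightarrow> f \<circ> g \<in> carrier W_ext"
  by (metis W_ext_mult group.is_monoid group_W_ext monoid.m_closed)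

lemma W_ext_funpow_closed: "f \<in> carrier W_ext \<Longrightarrow> f ^^ n \<in> carrier W_ext"
proof (induct n)
  case 0
  show ?case using monoid.one_closed[OF group.is_monoid[OF group_W_ext]] by (simp add: W_ext_one id_def)
qed (simp add: W_ext_comp_closed)

lemma generators_in_W_ext: "{w 0, w 1, w 2, w 3, w 4, sigma0, sigma1} \<subseteq> carrier W_ext"
  unfolding W_ext_def
  using group.subgroup_generated_subset_carrier_subset[OF group_AutoGroup_pic W_ext_generators] .

lemma elements_in_W_ext: "psi \<in> carrier W_ext" "phi \<in> carrier W_ext" "varphi \<in> carrier W_ext"
  using generators_in_W_ext
  by (simp_all add: psi_def phi_def varphi_def sigma2_def W_ext_comp_closed W_ext_funpow_closed)

text \<open>This is matrix-vector multiplication in coordinates. The induction on the free abelian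
  group runs over zero, basis elements and differences, all of which an additive map
  respects.\<close>

lemma lookup_additive:
  assumes "\<And>C D. f (C + D) = f C + f D"
  shows "Poly_Mapping.lookup (f C) a =
    (\<Sum>k = 0..<10. Poly_Mapping.lookup (f (frag_of (pic_basis_list ! k))) a * Poly_Mapping.lookup C (pic_basis_list ! k))"
proof -
  have f0: "f 0 = 0" using assms[of 0 0] by simp
  have fdiff: "f (C - D) = f C - f D" for C D using assms[of "C - D" D] by simp
  have "Poly_Mapping.keys C \<subseteq> UNIV" by simp
  then show ?thesis
  proof (rule free_Abelian_group_induct)
    fix b
    obtain i where i: "i < 10" "b = pic_basis_list ! i"
    proof -
      have "b \<in> set pic_basis_list" by (cases b) (simp_all add: pic_basis_list_def)
      then show ?thesis using that by (auto simp: in_set_conv_nth length_pic_basis_list)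
    qed
    have "(\<Sum>k = 0..<10. Poly_Mapping.lookup (f (frag_of (pic_basis_list ! k))) a
        * Poly_Mapping.lookup (frag_of b) (pic_basis_list ! k)) =
      (\<Sum>k = 0..<10. if i = k then Poly_Mapping.lookup (f (frag_of (pic_basis_list ! k))) a else 0)"
      by (intro sum.cong) (auto simp: i lookup_single pic_basis_list_nth_eq_iff)
    then show "Poly_Mapping.lookup (f (frag_of b)) a = (\<Sum>k = 0..<10. Poly_Mapping.lookup
        (f (frag_of (pic_basis_list ! k))) a * Poly_Mapping.lookup (frag_of b) (pic_basis_list ! k))"
      using i by simp
  qed (simp_all add: f0 fdiff lookup_minus right_diff_distrib sum_subtractf)
qed

text \<open>Additivity is asked of the outer map, which has to be expanded on the combinations
  \<open>g b\<close> of basis elements.\<close>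

lemma complexified_matrix_comp:
  assumes "\<And>C D. f (C + D) = f C + f D"
  shows "complexified_matrix (f \<circ> g) = complexified_matrix f * complexified_matrix g"
proof (rule eq_matI)
  fix i j
  assume "i < dim_row (complexified_matrix f * complexified_matrix g)"
    "j < dim_col (complexified_matrix f * complexified_matrix g)"
  then show "complexified_matrix (f \<circ> g) $$ (i, j) = (complexified_matrix f * complexified_matrix g) $$ (i, j)"
    using lookup_additive[of f "g (frag_of (pic_basis_list ! j))" "pic_basis_list ! i", OF assms]
    by (simp add: complexified_matrix_def scalar_prod_def)
qed (simp_all add: complexified_matrix_def)

lemma complexified_matrix_id: "complexified_matrix id = 1\<^sub>m 10"
  by (rule eq_matI) (auto simp: complexified_matrix_def lookup_single pic_basis_list_nth_eq_iff)

text \<open>Taking matrices is multiplicative on \<open>W_ext\<close>, so the matrices of the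
  conjugating element and of its inverse realise the similarity.\<close>

lemma conjugate_in_W_ext_imp_similar:
  assumes "conjugate_in W_ext x y" "x \<in> carrier W_ext"
  shows "similar_mat (complexified_matrix y) (complexified_matrix x)"
proof -
  interpret W: group W_ext by (rule group_W_ext)
  obtain g where g: "g \<in> carrier W_ext" "y = g \<otimes>\<^bsub>W_ext\<^esub> x \<otimes>\<^bsub>W_ext\<^esub> inv\<^bsub>W_ext\<^esub> g"
    using assms(1) by (auto simp: conjugate_in_def)
  define h where "h = inv\<^bsub>W_ext\<^esub> g"
  have h: "h \<in> carrier W_ext" using g by (simp add: h_def)
  have add: "f (C + D) = f C + f D" if "f \<in> carrier W_ext" for f C D
    using subsetD[OF W_ext_subset_auto that] by (simp add: auto_pic_iff)
  have M: "complexified_matrix (f \<otimes>\<^bsub>W_ext\<^esub> k) = complexified_matrix f * complexified_matrix k"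
    if "f \<in> carrier W_ext" "k \<in> carrier W_ext" for f k
    using complexified_matrix_comp[of f k, OF add] that by (simp add: W_ext_mult)
  have "complexified_matrix g * complexified_matrix h = 1\<^sub>m 10"
    "complexified_matrix h * complexified_matrix g = 1\<^sub>m 10"
    using g h by (simp_all add: h_def complexified_matrix_id W_ext_one flip: M)
  moreover have "complexified_matrix y = complexified_matrix g * complexified_matrix x * complexified_matrix h"
    using g h assms(2) by (simp add: M flip: h_def)
  ultimately show ?thesis
    by (intro similar_matI[where n = 10]) (auto simp: complexified_matrix_def)
qed

text \<open>Conjugacy would carry the normal form of \<open>x\<close> over to \<open>y\<close>, and
  by uniqueness both lists would contain the same blocks; \<open>p\<close> is a block that separates
  them.\<close>

lemma not_conjugate_in_W_ext:
  assumes "jordan_nf (complexified_matrix x) js" "jordan_nf (complexified_matrix y) ks"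
    and "x \<in> carrier W_ext" "p \<in> set ks" "p \<notin> set js"
  shows "\<not> conjugate_in W_ext x y"
proof
  assume "conjugate_in W_ext x y"
  from conjugate_in_W_ext_imp_similar[OF this assms(3)] assms(1)
  have "jordan_nf (complexified_matrix y) js"
    by (auto simp: jordan_nf_def intro: similar_mat_trans)
  from jordan_nf_unique[OF this assms(2)] assms(4,5) show False by simp
qed

section \<open>Sixth roots of unity\<close>

lemma cube_root_of_unity_exp:
  defines "\<omega> \<equiv> exp (2 * complex_of_real pi * \<i> / 3)"
  shows "\<omega> * \<omega> = - 1 - \<omega>"
    "exp (complex_of_real pi * \<i> / 3) = 1 + \<omega>"
    "exp (4 * complex_of_real pi * \<i> / 3) = - 1 - \<omega>"
    "exp (5 * complex_of_real pi * \<i> / 3) = - \<omega>"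
proof -
  \<comment> \<open>Every exponential in the statement is a power of this primitive sixth root of
    unity.\<close>
  define z where "z = exp (complex_of_real pi * \<i> / 3)"
  have z: "z = Complex (1 / 2) (sqrt 3 / 2)"
    unfolding z_def using cis_conv_exp[of "pi / 3"] by (simp add: cis.ctr cos_60 sin_60 mult.commute)
  \<comment> \<open>This is the sixth cyclotomic equation; the rest follows from it
    algebraically.\<close>
  have z2: "z ^ 2 = z - 1"
    by (simp add: z complex_eq_iff power2_eq_square)
  have \<omega>: "\<omega> = z ^ 2"
    unfolding \<omega>_def z_def exp_of_nat_mult[symmetric] by (simp add: field_simps)
  have p: "exp (4 * complex_of_real pi * \<i> / 3) = z ^ 4" "exp (5 * complex_of_real pi * \<i> / 3) = z ^ 5"
    unfolding z_def exp_of_nat_mult[symmetric] by (simp_all add: field_simps)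
  have "z ^ 3 = z * z ^ 2" by (simp add: power3_eq_cube power2_eq_square)
  also have "\<dots> = z * (z - 1)" by (simp only: z2)
  also have "\<dots> = z ^ 2 - z" by (simp add: algebra_simps power2_eq_square)
  finally have z3: "z ^ 3 = - 1" by (simp add: z2)
  have z45: "z ^ 4 = - z" "z ^ 5 = - (z ^ 2)"
    using z3 by (simp_all add: numeral_eq_Suc)
  have "\<omega> * \<omega> = z ^ 4" by (simp add: \<omega> flip: power_add)
  then show "\<omega> * \<omega> = - 1 - \<omega>" by (simp add: z45 \<omega> z2)
  show "exp (complex_of_real pi * \<i> / 3) = 1 + \<omega>" by (simp add: \<omega> z2 flip: z_def)
  show "exp (4 * complex_of_real pi * \<i> / 3) = - 1 - \<omega>"
    "exp (5 * complex_of_real pi * \<i> / 3) = - \<omega>" by (simp_all add: p z45 z2 \<omega>)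
qed

theorem mainTheorem2:
  shows
    "psi \<in> carrier W_ext \<and> phi \<in> carrier W_ext \<and> varphi \<in> carrier W_ext
     \<and> translates_roots psi [0, 0, 0, -1, 1]
     \<and> translates_roots phi [0, 1, -1, 0, 0]
     \<and> translates_roots varphi [0, 1, -1, -1, 1]
     \<and> \<not> conjugate_in W_ext psi phi
     \<and> \<not> conjugate_in W_ext psi varphi
     \<and> \<not> conjugate_in W_ext phi varphi
     \<and> jordan_nf (complexified_matrix psi)
         (replicate 3 (1, -1) @ replicate 4 (1, 1) @ [(3, 1)])
     \<and> jordan_nf (complexified_matrix phi)
         (replicate 3 (1, 1) @ [(3, 1)]
          @ replicate 2 (1, exp (2 * complex_of_real pi * \<i> / 3))
          @ replicate 2 (1, exp (4 * complex_of_real pi * \<i> / 3)))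
     \<and> jordan_nf (complexified_matrix varphi)
         ([(1, -1)] @ replicate 2 (1, 1) @ [(3, 1)]
          @ [(1, exp (complex_of_real pi * \<i> / 3)),
             (1, exp (2 * complex_of_real pi * \<i> / 3)),
             (1, exp (4 * complex_of_real pi * \<i> / 3)),
             (1, exp (5 * complex_of_real pi * \<i> / 3))])"
proof -
  define \<omega> where "\<omega> = exp (2 * complex_of_real pi * \<i> / 3)"
  note \<omega> = cube_root_of_unity_exp[folded \<omega>_def]
  have jpsi: "jordan_nf (complexified_matrix psi) (replicate 3 (1, -1) @ replicate 4 (1, 1) @ [(3, 1)])"
    using jordan_nf_psi_rows by (simp only: complexified_matrix_psi)
  have jphi: "jordan_nf (complexified_matrix phi)
      (replicate 3 (1, 1) @ [(3, 1)] @ replicate 2 (1, \<omega>) @ replicate 2 (1, - 1 - \<omega>))"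
    using jordan_nf_phi_rows[OF \<omega>(1)] by (simp only: complexified_matrix_phi)
  have jvarphi: "jordan_nf (complexified_matrix varphi)
      ([(1, -1)] @ replicate 2 (1, 1) @ [(3, 1)]
        @ [(1, 1 + \<omega>), (1, \<omega>), (1, - 1 - \<omega>), (1, - \<omega>)])"
    using jordan_nf_varphi_rows[OF \<omega>(1)] by (simp only: complexified_matrix_varphi)
  \<comment> \<open>Each excluded value contradicts the quadratic relation of \<omega>. These
    inequalities keep the separating blocks below out of the other list.\<close>
  have ne: "\<omega> \<noteq> 0" "\<omega> \<noteq> 1" "\<omega> \<noteq> -1"
    using \<omega>(1) by auto
  \<comment> \<open>All eigenvalues of \<open>psi\<close> are 1 or -1, so a block for \<omega>
    separates it from both \<open>phi\<close> and \<open>varphi\<close>.\<close>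
  have "\<not> conjugate_in W_ext psi phi"
    by (rule not_conjugate_in_W_ext[OF jpsi jphi elements_in_W_ext(1), of "(1, \<omega>)"])
      (use ne in simp_all)
  moreover have "\<not> conjugate_in W_ext psi varphi"
    by (rule not_conjugate_in_W_ext[OF jpsi jvarphi elements_in_W_ext(1), of "(1, \<omega>)"])
      (use ne in simp_all)
  \<comment> \<open>The eigenvalue -1 occurs for \<open>varphi\<close>, while those of
    \<open>phi\<close> are cube roots of unity.\<close>
  moreover have "\<not> conjugate_in W_ext phi varphi"
    by (rule not_conjugate_in_W_ext[OF jphi jvarphi elements_in_W_ext(2), of "(1, -1)"])
      (use ne in simp_all)
  ultimately show ?thesis
    using jpsi jphi jvarphi
    by (simp only: \<omega> elements_in_W_ext translates_roots_psi translates_roots_phi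
        translates_roots_varphi simp_thms flip: \<omega>_def)
qed

end
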